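(* Let $Z\in\mathbb R^n$ be a random vector and $\alpha:\mathbb R_+\to\mathbb R_+$ a nonincreasing function such that for every $1$-Lipschitz function $f:\mathbb R^n\to\mathbb R$ and every $t\ge0$, $$\mathbb P\left(|f(Z)-m_f|>t\right)\le\alpha(t)$$ for some median $m_f$ of $f(Z)$. Let $d\ge1$ be an integer. Then for any $d$-times differentiable map $\Phi:\mathbb R^n\to\mathbb R^p$ with bounded $d$-th differential and any $1$-Lipschitz function $g:\mathbb R^p\to\mathbb R$, $$\forall t\ge0:\qquad \mathbb P\left(|g(\Phi(Z))-m_g|>t\right)\le 2^d\,\alpha\left(\frac1e\min_{k\in\{1,\dots,d\}}\left(\frac{t}{d\,m_k}\right)^{1/k}\right),$$ where $m_g$ is a median of $g(\Phi(Z))$, for each $k\in\{1,\dots,d-1\}$ the quantity $m_k$ is a median of $\|d^k\Phi|_Z\|$, and $m_d=\|d^d\Phi\|_\infty$.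
   Context: $\mathbb R^n,\mathbb R^p$ carry the Euclidean norm. $d^k\Phi|_x$ is the $k$-th differential of $\Phi$ at $x$, a $k$-linear map $(\mathbb R^n)^k\to\mathbb R^p$. For a $k$-linear map $h$, $\|h\|=\sup\{\|h(x_1,\dots,x_k)\|:\|x_1\|,\dots,\|x_k\|\le1\}$, and $\|d^d\Phi\|_\infty=\sup_{x}\|d^d\Phi|_x\|$. A median $m$ of a real random variable $Y$ satisfies $\mathbb P(Y\ge m)\ge\frac12$ and $\mathbb P(Y\le m)\ge\frac12$. Convention when some $m_k=0$: for $t>0$ the corresponding term is $+\infty$ (it is dropped from the minimum), and if all $m_k=0$ the right-hand side is read as $0$ for $t>0$; for $t=0$ the minimum is read as $0$. *)

theory Defs
  imports "HOL-Probability.Probability"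
begin

text \<open>A \<open>k\<close>-linear map is represented by a function on lists of which only the values on lists
  of length \<open>k\<close> matter.\<close>

definition k_linear :: "nat \<Rightarrow> ('a::real_vector list \<Rightarrow> 'b::real_vector) \<Rightarrow> bool" where
  "k_linear k h \<longleftrightarrow> (\<forall>hs i. length hs = k \<longrightarrow> i < k \<longrightarrow> linear (\<lambda>v. h (hs[i := v])))"

definition k_linear_norm ::
  "nat \<Rightarrow> ('a::real_normed_vector list \<Rightarrow> 'b::real_normed_vector) \<Rightarrow> real" where
  "k_linear_norm k h = (SUP hs\<in>{hs. length hs = k \<and> (\<forall>v\<in>set hs. norm v \<le> 1)}. norm (h hs))"

text \<open>The \<open>k\<close>-th differential at \<open>x\<close>:
  \<open>d\<^sup>k\<^sup>+\<^sup>1\<Phi>|\<^sub>x(v, v\<^sub>1, \<dots>, v\<^sub>k)\<close> is the derivative at \<open>x\<close>, in the direction \<open>v\<close>, of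
  \<open>y \<mapsto> d\<^sup>k\<Phi>|\<^sub>y(v\<^sub>1, \<dots>, v\<^sub>k)\<close>. It is meaningful only for the orders at which \<open>\<Phi>\<close> is
  differentiable in the sense of \<open>times_differentiable\<close> below.\<close>

fun differential ::
  "nat \<Rightarrow> ('a::real_normed_vector \<Rightarrow> 'b::real_normed_vector) \<Rightarrow> 'a \<Rightarrow> 'a list \<Rightarrow> 'b" where
  "differential 0 \<Phi> x hs = \<Phi> x"
| "differential (Suc k) \<Phi> x hs =
     frechet_derivative (\<lambda>y. differential k \<Phi> y (tl hs)) (at x) (hd hs)"

text \<open>\<open>F\<close>, with values in the \<open>k\<close>-linear maps normed by \<open>k_linear_norm\<close>, is Frechet differentiable
  at \<open>x\<close>; its derivative \<open>v \<mapsto> F' (v # _)\<close> is a linear map into the \<open>k\<close>-linear maps,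
  that is, a \<open>(k+1)\<close>-linear map.  In finite dimension (the case of interest) all
  multilinear maps are bounded, so the suprema involved are finite.\<close>

definition has_k_linear_derivative ::
  "nat \<Rightarrow> ('a::real_normed_vector \<Rightarrow> 'a list \<Rightarrow> 'b::real_normed_vector) \<Rightarrow> ('a list \<Rightarrow> 'b) \<Rightarrow> 'a \<Rightarrow> bool"
where
  "has_k_linear_derivative k F F' x \<longleftrightarrow> k_linear (Suc k) F' \<and>
     ((\<lambda>y. k_linear_norm k (\<lambda>hs. F y hs - F x hs - F' ((y - x) # hs)) / norm (y - x)) \<longlongrightarrow> 0) (at x)"

definition times_differentiable ::
  "nat \<Rightarrow> ('a::real_normed_vector \<Rightarrow> 'b::real_normed_vector) \<Rightarrow> bool" where
  "times_differentiable d \<Phi> \<longleftrightarrow>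
     (\<forall>k<d. \<forall>x. has_k_linear_derivative k (differential k \<Phi>) (differential (Suc k) \<Phi> x) x)"

definition is_median :: "'w measure \<Rightarrow> ('w \<Rightarrow> real) \<Rightarrow> real \<Rightarrow> bool" where
  "is_median M Y m \<longleftrightarrow>
     measure M {\<omega> \<in> space M. Y \<omega> \<ge> m} \<ge> 1/2 \<and> measure M {\<omega> \<in> space M. Y \<omega> \<le> m} \<ge> 1/2"

text \<open>The bound \<open>2\<^sup>d \<alpha>(e\<^sup>-\<^sup>1 min\<^sub>k (t / (d m\<^sub>k))\<^sup>1\<^sup>/\<^sup>k)\<close>, \<open>k\<close> ranging over \<open>1, \<dots>, d\<close>, with its conventions:
  the minimum is \<open>0\<close> for \<open>t = 0\<close>; for \<open>t > 0\<close>, indices with \<open>m\<^sub>k = 0\<close> give the term \<open>+\<infinity>\<close> and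
  are dropped, and the bound is \<open>0\<close> when none remains.\<close>

definition concentration_bound ::
  "nat \<Rightarrow> (real \<Rightarrow> real) \<Rightarrow> (nat \<Rightarrow> real) \<Rightarrow> real \<Rightarrow> real" where
  "concentration_bound d \<alpha> m t =
     (if t = 0 then 2 ^ d * \<alpha> 0
      else if \<forall>k\<in>{1..d}. m k = 0 then 0
      else 2 ^ d * \<alpha> (1 / exp 1 *
             Min ((\<lambda>k. root k (t / (real d * m k))) ` {k\<in>{1..d}. m k \<noteq> 0})))"

end

theory Submission imports Defs begin

text \<open>Write \<open>h\<^sub>k\<close> for the norm of the \<open>k\<close>-th differential of \<open>\<Phi>\<close>, let \<open>r\<close> be the argument of \<open>\<alpha>\<close> in
  the bound, and let \<open>R = e r\<close>, so that \<open>m\<^sub>k R\<^sup>k \<le> t / d\<close>.  The bound is trivial unless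
  \<open>\<alpha> r < 2\<^sup>-\<^sup>d\<close>.  In that case a set of probability above \<open>\<alpha> r\<close> lies within distance \<open>2r\<close> of \<open>Z\<close>
  outside an event of probability \<open>\<alpha> r\<close>, by concentration of the distance function.  By downward
  induction on \<open>k\<close>, outside an event of probability \<open>(d - k) \<alpha> r\<close>, one has
  \<open>h\<^sub>j(Z) R\<^sup>j \<le> (d - j + 1) t / d\<close> for all \<open>j \<ge> k\<close>: a typical point is within \<open>2r\<close> of a typical point
  where moreover \<open>h\<^sub>k \<le> m\<^sub>k\<close>, and Taylor expansion from both points to their midpoint bounds the
  variation of the \<open>k\<close>-th differential between them by the higher orders, because
  \<open>2 (exp (1/e) - 1) \<le> 1\<close>.  The same comparison for \<open>k = 0\<close> gives the deviation of \<open>g \<circ> \<Phi>\<close>.  When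
  all \<open>m\<^sub>k\<close> vanish, \<open>\<Phi>\<close> is constant.\<close>

declare differential.simps(2) [simp del]

subsection \<open>Multilinear maps\<close>

lemma k_linear_Cons:
  assumes "k_linear (Suc k) h"
  shows "k_linear k (\<lambda>hs. h (v # hs))"
  unfolding k_linear_def
proof (intro allI impI)
  fix hs :: "'a list" and i assume "length hs = k" "i < k"
  then have "linear (\<lambda>w. h ((v # hs)[Suc i := w]))"
    using assms unfolding k_linear_def by (metis Suc_less_eq length_Cons)
  then show "linear (\<lambda>w. h (v # hs[i := w]))" by simp
qed

lemma k_linear_hd:
  assumes "k_linear (Suc k) h" "length hs = k"
  shows "linear (\<lambda>v. h (v # hs))"
proof -
  have "linear (\<lambda>v. h ((0 # hs)[0 := v]))"
    using assms unfolding k_linear_def by (metis length_Cons zero_less_Suc)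
  then show ?thesis by simp
qed

lemma k_linear_diff:
  assumes "k_linear k f" "k_linear k g"
  shows "k_linear k (\<lambda>hs. f hs - g hs)"
  using assms unfolding k_linear_def by (auto intro!: linear_compose_sub)

lemma k_linear_0: "k_linear 0 h"
  by (simp add: k_linear_def)

text \<open>Finite dimension enters here: the first argument is expanded in the orthonormal basis,
  with coordinates at most 1 in modulus, and induction handles the others. Thus
  \<open>k_linear_norm\<close> is a supremum over a bounded set.\<close>

lemma k_linear_bounded_on_unit_balls:
  fixes h :: "'a::euclidean_space list \<Rightarrow> 'b::real_normed_vector"
  assumes "k_linear k h"
  shows "\<exists>C. \<forall>hs. length hs = k \<longrightarrow> (\<forall>v\<in>set hs. norm v \<le> 1) \<longrightarrow> norm (h hs) \<le> C"
  using assms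
proof (induction k arbitrary: h)
  case 0
  show ?case by auto
next
  case (Suc k)
  have "\<exists>C. \<forall>hs. length hs = k \<longrightarrow> (\<forall>v\<in>set hs. norm v \<le> 1) \<longrightarrow> norm (h (b # hs)) \<le> C" for b
    using Suc.IH[OF k_linear_Cons[OF Suc.prems]] .
  then obtain C where C: "\<And>b hs. length hs = k \<Longrightarrow> \<forall>v\<in>set hs. norm v \<le> 1 \<Longrightarrow> norm (h (b # hs)) \<le> C b"
    by metis
  show ?case
  proof (intro exI allI impI)
    fix hs :: "'a list" assume len: "length hs = Suc k" and unit: "\<forall>v\<in>set hs. norm v \<le> 1"
    then obtain v ws where hs: "hs = v # ws" by (cases hs) auto
    have lin: "linear (\<lambda>v. h (v # ws))"
      using k_linear_hd[OF Suc.prems] len hs by simp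
    have "h hs = h ((\<Sum>b\<in>Basis. (v \<bullet> b) *\<^sub>R b) # ws)"
      by (simp add: hs euclidean_representation)
    also have "\<dots> = (\<Sum>b\<in>Basis. (v \<bullet> b) *\<^sub>R h (b # ws))"
      using linear_sum[OF lin, of "\<lambda>b. (v \<bullet> b) *\<^sub>R b" Basis] linear_cmul[OF lin] by simp
    finally have "norm (h hs) \<le> (\<Sum>b\<in>Basis. \<bar>v \<bullet> b\<bar> * norm (h (b # ws)))"
      by (metis (no_types, lifting) norm_scaleR norm_sum sum.cong)
    also have "\<dots> \<le> (\<Sum>b\<in>Basis. 1 * C b)"
    proof (rule sum_mono)
      fix b :: 'a assume b: "b \<in> Basis"
      have "\<bar>v \<bullet> b\<bar> \<le> 1" using Basis_le_norm[OF b, of v] unit hs by auto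
      moreover have "norm (h (b # ws)) \<le> C b" using C len unit hs by auto
      ultimately show "\<bar>v \<bullet> b\<bar> * norm (h (b # ws)) \<le> 1 * C b"
        by (intro mult_mono) auto
    qed
    finally show "norm (h hs) \<le> (\<Sum>b\<in>Basis. 1 * C b)" .
  qed
qed

lemma norm_le_k_linear_norm:
  fixes h :: "'a::euclidean_space list \<Rightarrow> 'b::real_normed_vector"
  assumes "k_linear k h" "length hs = k" "\<forall>v\<in>set hs. norm v \<le> 1"
  shows "norm (h hs) \<le> k_linear_norm k h"
proof -
  obtain C where "\<And>hs. length hs = k \<Longrightarrow> \<forall>v\<in>set hs. norm v \<le> 1 \<Longrightarrow> norm (h hs) \<le> C"
    using k_linear_bounded_on_unit_balls[OF assms(1)] by blast
  then have "bdd_above ((\<lambda>hs. norm (h hs)) ` {hs. length hs = k \<and> (\<forall>v\<in>set hs. norm v \<le> 1)})"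
    by (intro bdd_aboveI[of _ C]) auto
  then show ?thesis
    unfolding k_linear_norm_def using assms by (intro cSUP_upper) auto
qed

lemma k_linear_norm_le:
  assumes "\<And>hs. length hs = k \<Longrightarrow> \<forall>v\<in>set hs. norm v \<le> 1 \<Longrightarrow> norm (h hs) \<le> C"
  shows "k_linear_norm k h \<le> C"
proof -
  have "replicate k 0 \<in> {hs. length hs = k \<and> (\<forall>v\<in>set hs. norm v \<le> 1)}" by auto
  then show ?thesis
    unfolding k_linear_norm_def by (intro cSUP_least) (blast, simp add: assms)
qed

lemma k_linear_norm_nonneg:
  fixes h :: "'a::euclidean_space list \<Rightarrow> 'b::real_normed_vector"
  assumes "k_linear k h"
  shows "0 \<le> k_linear_norm k h"
  using order_trans[OF norm_ge_zero norm_le_k_linear_norm[OF assms, of "replicate k 0"]] by simp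

text \<open>The first slot will hold an increment \<open>u\<close> of arbitrary length while the
  other slots stay in the unit ball; homogeneity extracts the factor \<open>norm u\<close>.\<close>

lemma norm_le_k_linear_norm_Cons:
  fixes h :: "'a::euclidean_space list \<Rightarrow> 'b::real_normed_vector"
  assumes "k_linear (Suc k) h" "length hs = k" "\<forall>v\<in>set hs. norm v \<le> 1"
  shows "norm (h (u # hs)) \<le> norm u * k_linear_norm (Suc k) h"
proof -
  have lin: "linear (\<lambda>v. h (v # hs))" using k_linear_hd assms by blast
  have "norm (h (sgn u # hs)) \<le> k_linear_norm (Suc k) h"
    using assms by (intro norm_le_k_linear_norm) (auto simp: norm_sgn)
  then have "norm u * norm (h (sgn u # hs)) \<le> norm u * k_linear_norm (Suc k) h"
    by (intro mult_left_mono) auto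
  moreover have "h (u # hs) = norm u *\<^sub>R h (sgn u # hs)"
    using linear_cmul[OF lin, of "norm u" "sgn u"] by (cases "u = 0") (auto simp: sgn_div_norm)
  ultimately show ?thesis by simp
qed

lemma k_linear_norm_le_add:
  fixes f g :: "'a::euclidean_space list \<Rightarrow> 'b::real_normed_vector"
  assumes "k_linear k g"
    and "\<And>hs. length hs = k \<Longrightarrow> \<forall>v\<in>set hs. norm v \<le> 1 \<Longrightarrow> norm (f hs - g hs) \<le> C"
  shows "k_linear_norm k f \<le> k_linear_norm k g + C"
proof (rule k_linear_norm_le)
  fix hs :: "'a list" assume hs: "length hs = k" "\<forall>v\<in>set hs. norm v \<le> 1"
  have "norm (f hs) \<le> norm (g hs) + norm (f hs - g hs)" by (rule norm_triangle_sub)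
  then show "norm (f hs) \<le> k_linear_norm k g + C"
    using norm_le_k_linear_norm[OF assms(1) hs] assms(2)[OF hs] by linarith
qed

subsection \<open>Taylor estimates for higher differentials\<close>

lemma k_linear_differential:
  assumes "times_differentiable d \<Phi>" "k \<le> d"
  shows "k_linear k (differential k \<Phi> x)"
proof (cases k)
  case 0 then show ?thesis by (simp add: k_linear_0)
next
  case (Suc j) then show ?thesis
    using assms unfolding times_differentiable_def has_k_linear_derivative_def by auto
qed

text \<open>At fixed \<open>hs\<close> in the unit ball the remainder is dominated by its
  \<open>k_linear_norm\<close>, so differentiability in norm passes to each evaluation.\<close>

lemma differential_has_derivative:
  fixes \<Phi> :: "'a::euclidean_space \<Rightarrow> 'b::real_normed_vector"
  assumes \<Phi>: "times_differentiable d \<Phi>" and "k < d"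
    and hs: "length hs = k" "\<forall>v\<in>set hs. norm v \<le> 1"
  shows "((\<lambda>y. differential k \<Phi> y hs) has_derivative (\<lambda>v. differential (Suc k) \<Phi> x (v # hs))) (at x)"
proof -
  let ?F = "differential k \<Phi>" and ?F' = "differential (Suc k) \<Phi> x"
  let ?rem = "\<lambda>y hs. ?F y hs - ?F x hs - ?F' ((y - x) # hs)"
  have lin: "k_linear (Suc k) ?F'"
    and lim: "((\<lambda>y. k_linear_norm k (?rem y) / norm (y - x)) \<longlongrightarrow> 0) (at x)"
    using \<Phi> \<open>k < d\<close> unfolding times_differentiable_def has_k_linear_derivative_def by auto
  have rem_le: "norm (?rem y hs) \<le> k_linear_norm k (?rem y)" for y
    using k_linear_differential[OF \<Phi>, of k] \<open>k < d\<close> k_linear_Cons[OF lin] hs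
    by (intro norm_le_k_linear_norm k_linear_diff) auto
  have "((\<lambda>y. norm (?rem y hs) / norm (y - x)) \<longlongrightarrow> 0) (at x)"
    by (rule tendsto_sandwich[OF _ _ tendsto_const lim])
      (auto intro!: always_eventually divide_right_mono rem_le)
  moreover have "bounded_linear (\<lambda>v. ?F' (v # hs))"
    using k_linear_hd[OF lin hs(1)] linear_conv_bounded_linear by blast
  ultimately show ?thesis
    unfolding has_derivative_iff_norm by simp
qed

text \<open>Downward induction on \<open>k\<close> with the mean value inequality on the segment
  from \<open>x\<close> to \<open>z\<close>: the estimate at order \<open>k + 1\<close> bounds the
  derivative along the segment by a polynomial, whose primitive gives order \<open>k\<close>. Only
  the top order is bounded globally; the others are bounded at the base point
  \<open>x\<close>.\<close>

lemma norm_differential_diff_le: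
  fixes \<Phi> :: "'a::euclidean_space \<Rightarrow> 'b::real_normed_vector"
  assumes \<Phi>: "times_differentiable d \<Phi>"
    and top: "\<And>z. k_linear_norm d (differential d \<Phi> z) \<le> C d"
    and "k < d"
    and "\<And>j. k < j \<Longrightarrow> j < d \<Longrightarrow> k_linear_norm j (differential j \<Phi> x) \<le> C j"
    and "length hs = k" "\<forall>v\<in>set hs. norm v \<le> 1"
  shows "norm (differential k \<Phi> z hs - differential k \<Phi> x hs)
    \<le> (\<Sum>i<d - k. C (k + 1 + i) * norm (z - x) ^ Suc i / fact (Suc i))"
  using assms(3-)
proof (induction "d - k" arbitrary: k hs z rule: less_induct)
  case (less k hs z)
  define u where "u = z - x"
  let ?D = "\<lambda>j s. differential j \<Phi> (x + s *\<^sub>R u)"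
  \<comment> \<open>The majorant along the segment: it vanishes at 0, its value at 1 is the asserted
    sum, and \<open>?\<phi>'\<close> is its derivative.\<close>
  let ?\<phi> = "\<lambda>s. \<Sum>i<d - k. C (k + 1 + i) * (s * norm u) ^ Suc i / fact (Suc i)"
  let ?\<phi>' = "\<lambda>s. norm u * (\<Sum>i<d - k. C (k + 1 + i) * (s * norm u) ^ i / fact i)"
  have der: "((\<lambda>s. ?D k s hs) has_vector_derivative ?D (Suc k) s (u # hs)) (at s)" for s
  proof -
    have "((\<lambda>s. x + s *\<^sub>R u) has_vector_derivative u) (at s)"
      by (auto intro!: derivative_eq_intros simp: has_vector_derivative_def)
    moreover have "((\<lambda>y. differential k \<Phi> y hs) has_derivative (\<lambda>v. ?D (Suc k) s (v # hs)))
        (at (x + s *\<^sub>R u))"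
      using differential_has_derivative[OF \<Phi>] less.prems by blast
    ultimately show ?thesis
      using vector_derivative_diff_chain_within[of "\<lambda>s. x + s *\<^sub>R u" u s UNIV,
          OF _ has_derivative_at_withinI]
      by (fastforce simp: o_def)
  qed
  have "((\<lambda>s. C (k + 1 + i) * (s * norm u) ^ Suc i / fact (Suc i)) has_real_derivative
      norm u * (C (k + 1 + i) * (s * norm u) ^ i / fact i)) (at s)" for i s
  proof -
    have "((\<lambda>s. (s * norm u) ^ Suc i) has_real_derivative
        real (Suc i) * (s * norm u) ^ i * norm u) (at s)"
      by (auto intro!: derivative_eq_intros simp del: power_Suc)
    then have "((\<lambda>s. (C (k + 1 + i) / fact (Suc i)) * (s * norm u) ^ Suc i) has_real_derivative
        (C (k + 1 + i) / fact (Suc i)) * (real (Suc i) * (s * norm u) ^ i * norm u)) (at s)"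
      by (rule DERIV_cmult)
    moreover have "(C (k + 1 + i) / fact (Suc i)) * (real (Suc i) * (s * norm u) ^ i * norm u)
        = norm u * (C (k + 1 + i) * (s * norm u) ^ i / fact i)"
      by (simp add: fact_Suc divide_simps del: of_nat_Suc)
    ultimately show ?thesis by (simp add: mult_ac)
  qed
  then have \<phi>: "(?\<phi> has_real_derivative ?\<phi>' s) (at s)" for s
    unfolding sum_distrib_left by (intro DERIV_sum)
  have bound: "norm (?D (Suc k) s (u # hs)) \<le> ?\<phi>' s" if "0 < s" for s
  proof -
    let ?y = "x + s *\<^sub>R u"
    let ?S = "\<Sum>i<d - Suc k. C (Suc k + 1 + i) * norm (?y - x) ^ Suc i / fact (Suc i)"
    have "k_linear_norm (Suc k) (differential (Suc k) \<Phi> ?y) \<le> C (Suc k) + ?S"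
    proof (cases "Suc k = d")
      case True
      then show ?thesis using top[of ?y] by simp
    next
      case False
      then have "Suc k < d" using less.prems by simp
      have "k_linear_norm (Suc k) (differential (Suc k) \<Phi> ?y)
          \<le> k_linear_norm (Suc k) (differential (Suc k) \<Phi> x) + ?S"
        using k_linear_differential[OF \<Phi>, of "Suc k" x] less.prems \<open>Suc k < d\<close>
        by (intro k_linear_norm_le_add less.hyps) auto
      then show ?thesis using less.prems(2)[of "Suc k"] \<open>Suc k < d\<close> by simp
    qed
    \<comment> \<open>\<open>C (Suc k)\<close> becomes the term \<open>i = 0\<close> after the index
      shift, and \<open>0 < s\<close> gives
      \<open>norm (s *\<^sub>R u) = s * norm u\<close>.\<close>
    also have "C (Suc k) + ?S = (\<Sum>i<Suc (d - Suc k). C (k + 1 + i) * (s * norm u) ^ i / fact i)"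
      using that by (subst sum.lessThan_Suc_shift) simp
    also have "Suc (d - Suc k) = d - k" using less.prems by simp
    finally have "norm u * k_linear_norm (Suc k) (differential (Suc k) \<Phi> ?y) \<le> ?\<phi>' s"
      by (rule mult_left_mono) simp
    moreover have "norm (?D (Suc k) s (u # hs))
        \<le> norm u * k_linear_norm (Suc k) (differential (Suc k) \<Phi> ?y)"
      using k_linear_differential[OF \<Phi>, of "Suc k" ?y] less.prems
      by (intro norm_le_k_linear_norm_Cons) auto
    ultimately show ?thesis by linarith
  qed
  have "norm (?D k 1 hs - ?D k 0 hs) \<le> ?\<phi> 1 - ?\<phi> 0"
  proof (rule differentiable_bound_general[OF zero_less_one])
    show "continuous_on {0..1} (\<lambda>s. ?D k s hs)"
      using der by (meson continuous_at_imp_continuous_on has_vector_derivative_continuous)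
    show "continuous_on {0..1} ?\<phi>"
      using \<phi> by (meson DERIV_isCont continuous_at_imp_continuous_on)
  qed (use der \<phi> bound in \<open>auto simp: has_real_derivative_iff_has_vector_derivative\<close>)
  then show ?case by (simp add: u_def)
qed

text \<open>The Taylor bound from the fixed base point \<open>x\<close> is a polynomial in
  \<open>norm (z - x)\<close> without constant term. Continuity makes the sublevel sets used below
  closed, hence measurable.\<close>

lemma continuous_on_k_linear_norm_differential:
  fixes \<Phi> :: "'a::euclidean_space \<Rightarrow> 'b::real_normed_vector"
  assumes \<Phi>: "times_differentiable d \<Phi>"
    and bdd: "bdd_above (range (\<lambda>x. k_linear_norm d (differential d \<Phi> x)))"
    and "k < d"
  shows "continuous_on UNIV (\<lambda>x. k_linear_norm k (differential k \<Phi> x))"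
proof (rule continuous_at_imp_continuous_on, intro ballI)
  fix x
  let ?h = "\<lambda>k x. k_linear_norm k (differential k \<Phi> x)"
  define C where "C = (\<lambda>j. if j = d then SUP x. ?h d x else ?h j x)"
  let ?S = "\<lambda>z. \<Sum>i<d - k. C (k + 1 + i) * norm (z - x) ^ Suc i / fact (Suc i)"
  have diff: "norm (differential k \<Phi> z hs - differential k \<Phi> x hs) \<le> ?S z"
    if "length hs = k" "\<forall>v\<in>set hs. norm v \<le> 1" for z hs
    by (rule norm_differential_diff_le[OF \<Phi> _ \<open>k < d\<close> _ that])
      (use cSUP_upper[OF UNIV_I bdd] in \<open>auto simp: C_def\<close>)
  \<comment> \<open>The reverse comparison keeps the base point \<open>x\<close>, so the constants
    \<open>C\<close> do not depend on \<open>z\<close>.\<close>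
  have diff': "norm (differential k \<Phi> x hs - differential k \<Phi> z hs) \<le> ?S z"
    if "length hs = k" "\<forall>v\<in>set hs. norm v \<le> 1" for z hs
    using diff[OF that, of z]
      norm_minus_commute[of "differential k \<Phi> x hs" "differential k \<Phi> z hs"] by linarith
  have "?h k z \<le> ?h k x + ?S z" "?h k x \<le> ?h k z + ?S z" for z
    using k_linear_differential[OF \<Phi>, of k] \<open>k < d\<close>
    by (intro k_linear_norm_le_add diff diff'; simp)+
  then have le: "norm (?h k z - ?h k x) \<le> ?S z" for z
    by (auto simp: abs_le_iff algebra_simps simp del: power_Suc)
  have "(?S \<longlongrightarrow> (\<Sum>i<d - k. C (k + 1 + i) * norm (x - x) ^ Suc i / fact (Suc i))) (at x)"
    by (intro tendsto_intros) auto
  then have "(?S \<longlongrightarrow> 0) (at x)" by simp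
  then have "((\<lambda>z. ?h k z - ?h k x) \<longlongrightarrow> 0) (at x)"
    by (rule Lim_null_comparison[rotated]) (intro always_eventually allI le)
  then show "isCont (?h k) x"
    by (simp add: isCont_def LIM_zero_iff)
qed

lemma continuous_on_times_differentiable:
  fixes \<Phi> :: "'a::euclidean_space \<Rightarrow> 'b::real_normed_vector"
  assumes "times_differentiable d \<Phi>" "1 \<le> d"
  shows "continuous_on UNIV \<Phi>"
proof -
  have "(\<Phi> has_derivative (\<lambda>v. differential (Suc 0) \<Phi> x [v])) (at x)" for x
    using differential_has_derivative[OF assms(1), of 0 "[]" x] assms(2) by simp
  then show ?thesis
    by (meson continuous_at_imp_continuous_on has_derivative_continuous)
qed

text \<open>Since \<open>2 ^ i \<le> fact (Suc i)\<close>, the terms are dominated by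
  \<open>2/5 * (1/5) ^ i\<close>, a geometric series with sum exactly 1/2; the induction carries its
  partial sums. The value 2/5 comes from \<open>exp 1 \<ge> 1 + 1 + 1/2\<close>.\<close>

lemma sum_power_div_fact_le:
  assumes "0 \<le> (q::real)" "q \<le> 2/5"
  shows "(\<Sum>i<n. q ^ Suc i / fact (Suc i)) \<le> 1/2"
proof -
  have "(\<Sum>i<n. q ^ Suc i / fact (Suc i)) \<le> 1/2 * (1 - (1/5) ^ n)"
  proof (induction n)
    case (Suc n)
    have "(2::real) ^ n \<le> fact (Suc n)"
      by (induction n) (auto intro!: mult_mono simp del: fact_Suc simp: fact_Suc[of "Suc _"])
    then have "q ^ Suc n / fact (Suc n) \<le> (2/5) ^ Suc n / 2 ^ n"
      using assms by (intro frac_le power_mono) auto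
    also have "\<dots> = 1/2 * (1 - (1/5) ^ Suc n) - 1/2 * (1 - (1/5) ^ n)"
      by (simp add: power_divide field_simps flip: power_mult_distrib)
    finally show ?case unfolding sum.lessThan_Suc using Suc.IH by linarith
  qed simp
  also have "\<dots> \<le> 1/2" by simp
  finally show ?thesis .
qed

lemma exp_minus_one_le: "exp (-1) \<le> (2/5::real)"
  using exp_lower_Taylor_quadratic[of 1] by (simp add: exp_minus field_simps)

text \<open>Expanding at both endpoints towards the midpoint, instead of at one endpoint over the
  distance \<open>2r\<close>, is what makes the constant \<open>e\<close> of the theorem attainable.\<close>

lemma norm_differential_diff_le_scaled:
  fixes \<Phi> :: "'a::euclidean_space \<Rightarrow> 'b::real_normed_vector"
  assumes \<Phi>: "times_differentiable d \<Phi>" and "k < d" and "0 < r" and "0 \<le> B"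
    and top: "\<And>z. k_linear_norm d (differential d \<Phi> z) * (exp 1 * r) ^ d \<le> B"
    and bnd: "\<And>j z. k < j \<Longrightarrow> j < d \<Longrightarrow> z \<in> {x, y} \<Longrightarrow>
      k_linear_norm j (differential j \<Phi> z) * (exp 1 * r) ^ j \<le> B"
    and "dist x y \<le> 2 * r"
    and hs: "length hs = k" "\<forall>v\<in>set hs. norm v \<le> 1"
  shows "norm (differential k \<Phi> x hs - differential k \<Phi> y hs) \<le> B / (exp 1 * r) ^ k"
proof -
  define R where "R = exp 1 * r"
  have "0 < R" using \<open>0 < r\<close> by (simp add: R_def)
  define z where "z = midpoint x y"
  have half: "norm (differential k \<Phi> z hs - differential k \<Phi> w hs) \<le> B / R ^ k / 2"
    if w: "w \<in> {x, y}" for w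
  proof -
    have "norm (z - w) = dist x y / 2"
      using w by (auto simp: z_def dist_norm[symmetric] dist_midpoint)
    then have "norm (z - w) \<le> r" using assms by simp
    \<comment> \<open>The base point is \<open>w\<close> and \<open>C j = B / R ^ j\<close>: after
      scaling by powers of \<open>R\<close> all orders share the bound \<open>B\<close>.\<close>
    have "norm (differential k \<Phi> z hs - differential k \<Phi> w hs)
        \<le> (\<Sum>i<d - k. B / R ^ (k + 1 + i) * norm (z - w) ^ Suc i / fact (Suc i))"
      using top bnd w \<open>0 < R\<close> \<open>k < d\<close> hs unfolding R_def
      by (intro norm_differential_diff_le[OF \<Phi>]) (auto simp: pos_le_divide_eq)
    also have "\<dots> \<le> (\<Sum>i<d - k. B / R ^ (k + 1 + i) * r ^ Suc i / fact (Suc i))"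
      using \<open>norm (z - w) \<le> r\<close> \<open>0 < R\<close> \<open>0 \<le> B\<close>
      by (intro sum_mono divide_right_mono mult_left_mono power_mono) auto
    \<comment> \<open>Here \<open>r / R = exp (-1)\<close>, which is at most 2/5, so each half of
      the segment costs half of \<open>B / R ^ k\<close>.\<close>
    also have "\<dots> = B / R ^ k * (\<Sum>i<d - k. exp (-1) ^ Suc i / fact (Suc i))"
      unfolding sum_distrib_left
    proof (rule sum.cong[OF refl])
      fix i
      have "r = exp (-1) * R" by (simp add: R_def flip: exp_add mult.assoc)
      then have "r ^ Suc i = exp (-1) ^ Suc i * R ^ Suc i" by (metis power_mult_distrib)
      moreover have "R ^ (k + 1 + i) = R ^ k * R ^ Suc i" by (simp add: power_add)
      ultimately show "B / R ^ (k + 1 + i) * r ^ Suc i / fact (Suc i)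
          = B / R ^ k * (exp (-1) ^ Suc i / fact (Suc i))"
        using \<open>0 < R\<close> by (simp del: power_Suc fact_Suc)
    qed
    also have "\<dots> \<le> B / R ^ k * (1 / 2)"
      using \<open>0 < R\<close> \<open>0 \<le> B\<close> exp_minus_one_le by (intro mult_left_mono sum_power_div_fact_le) auto
    finally show ?thesis by simp
  qed
  have "norm (differential k \<Phi> x hs - differential k \<Phi> y hs)
      \<le> norm (differential k \<Phi> z hs - differential k \<Phi> x hs)
        + norm (differential k \<Phi> z hs - differential k \<Phi> y hs)"
    by (metis dist_norm dist_triangle3)
  with half[of x] half[of y] show ?thesis unfolding R_def by simp
qed

lemma differential_eq_if_higher_vanish:
  fixes \<Phi> :: "'a::euclidean_space \<Rightarrow> 'b::real_normed_vector"
  assumes "times_differentiable d \<Phi>" "k < d"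
    and "\<And>j z. k < j \<Longrightarrow> j \<le> d \<Longrightarrow> k_linear_norm j (differential j \<Phi> z) \<le> 0"
    and "length hs = k" "\<forall>v\<in>set hs. norm v \<le> 1"
  shows "differential k \<Phi> x hs = differential k \<Phi> y hs"
  using norm_differential_diff_le[of d \<Phi> "\<lambda>_. 0" k y hs x] assms by simp

subsection \<open>Concentration\<close>

lemma median_set_nonempty:
  assumes "is_median M Y m"
  obtains \<omega> \<omega>' where "\<omega> \<in> space M" "Y \<omega> \<le> m" "\<omega>' \<in> space M" "m \<le> Y \<omega>'"
proof -
  have "{\<omega> \<in> space M. Y \<omega> \<le> m} \<noteq> {}" "{\<omega> \<in> space M. m \<le> Y \<omega>} \<noteq> {}"
    using assms unfolding is_median_def by (auto simp del: Collect_empty_eq)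
  then show thesis using that by blast
qed

text \<open>Downward from order \<open>d\<close>: once all higher orders vanish, the
  \<open>k\<close>-th differential is the same at all points, and a median 0 supplies a point where
  its norm is at most 0.\<close>

lemma constant_if_medians_vanish:
  fixes \<Phi> :: "'b::euclidean_space \<Rightarrow> 'c::real_normed_vector"
  assumes \<Phi>: "times_differentiable d \<Phi>" and "1 \<le> d"
    and top: "\<And>z. k_linear_norm d (differential d \<Phi> z) \<le> 0"
    and med: "\<And>k. 1 \<le> k \<Longrightarrow> k < d \<Longrightarrow>
      is_median M (\<lambda>\<omega>. k_linear_norm k (differential k \<Phi> (Z \<omega>))) 0"
  shows "\<Phi> x = \<Phi> y"
proof -
  have "k_linear_norm k (differential k \<Phi> z) \<le> 0" if "1 \<le> k" "k \<le> d" for k z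
    using that
  proof (induction "d - k" arbitrary: k z rule: less_induct)
    case (less k z)
    show ?case
    proof (cases "k = d")
      case False
      then have "k < d" using less.prems by simp
      have "k_linear_norm k (differential k \<Phi> z) \<le> k_linear_norm k (differential k \<Phi> w) + 0" for w
        using k_linear_differential[OF \<Phi>, of k] \<open>k < d\<close> less.prems less.hyps
          differential_eq_if_higher_vanish[OF \<Phi> \<open>k < d\<close>, of _ z w]
        by (intro k_linear_norm_le_add) auto
      moreover obtain \<omega> where "k_linear_norm k (differential k \<Phi> (Z \<omega>)) \<le> 0"
        using median_set_nonempty[OF med[OF \<open>1 \<le> k\<close> \<open>k < d\<close>]] by blast
      ultimately show ?thesis using order_trans by fastforce
    qed (use top in simp)
  qed
  then show ?thesis
    using differential_eq_if_higher_vanish[OF \<Phi>, of 0 "[]" x y] \<open>1 \<le> d\<close> by simp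
qed

section \<open>Concentration transferred through sets\<close>

definition concentrated :: "'w measure \<Rightarrow> ('w \<Rightarrow> 'a::euclidean_space) \<Rightarrow> (real \<Rightarrow> real) \<Rightarrow> bool" where
  "concentrated M Z \<alpha> \<longleftrightarrow> prob_space M \<and> Z \<in> borel_measurable M \<and>
     (\<forall>f. 1-lipschitz_on UNIV f \<longrightarrow>
       (\<exists>m. is_median M (\<lambda>\<omega>. f (Z \<omega>)) m \<and>
         (\<forall>t\<ge>0. measure M {\<omega> \<in> space M. \<bar>f (Z \<omega>) - m\<bar> > t} \<le> \<alpha> t)))"

lemma concentratedD:
  fixes Z :: "'w \<Rightarrow> 'a::euclidean_space"
  assumes "concentrated M Z \<alpha>"
  shows "prob_space M" "Z \<in> borel_measurable M"
    and "1-lipschitz_on UNIV f \<Longrightarrow>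
      \<exists>m. is_median M (\<lambda>\<omega>. f (Z \<omega>)) m \<and>
        (\<forall>t\<ge>0. measure M {\<omega> \<in> space M. \<bar>f (Z \<omega>) - m\<bar> > t} \<le> \<alpha> t)"
  using assms unfolding concentrated_def by blast+

lemma concentrated_mono:
  fixes Z :: "'w \<Rightarrow> 'a::euclidean_space"
  assumes "concentrated M Z \<alpha>" "A \<subseteq> B" "B \<in> sets M"
  shows "measure M A \<le> measure M B"
  using assms finite_measure.finite_measure_mono[of M A B] concentratedD(1) prob_space.axioms(1)
  by blast

lemma sets_vimage_closed:
  fixes Z :: "'w \<Rightarrow> 'a::euclidean_space"
  assumes conc: "concentrated M Z \<alpha>"
    and "closed S"
  shows "{\<omega> \<in> space M. Z \<omega> \<in> S} \<in> sets M" "{\<omega> \<in> space M. Z \<omega> \<notin> S} \<in> sets M"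
  using borel_closed[OF assms(2)] concentratedD(2)[OF conc] by measurable

lemma concentrated_bound_nonneg:
  fixes Z :: "'w \<Rightarrow> 'a::euclidean_space"
  assumes conc: "concentrated M Z \<alpha>"
    and "0 \<le> t"
  shows "0 \<le> \<alpha> t"
proof -
  have "1-lipschitz_on UNIV (\<lambda>_::'a. 0::real)" by (simp add: lipschitz_on_def)
  from concentratedD(3)[OF conc this] assms obtain m where "measure M {\<omega> \<in> space M. \<bar>0 - m\<bar> > t} \<le> \<alpha> t" by blast
  then show ?thesis by (rule order_trans[OF measure_nonneg])
qed

text \<open>The radius is \<open>2r\<close> and not \<open>r\<close> because the median provided for the distance to \<open>B\<close> is only
  known to be at most \<open>r\<close>.\<close>

lemma prob_infdist_gt_le:
  fixes Z :: "'w \<Rightarrow> 'a::euclidean_space"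
  assumes conc: "concentrated M Z \<alpha>"
    and "0 \<le> r" "closed B" and B: "\<alpha> r < measure M {\<omega> \<in> space M. Z \<omega> \<in> B}"
  shows "measure M {\<omega> \<in> space M. infdist (Z \<omega>) B > 2 * r} \<le> \<alpha> r"
proof -
  have "1-lipschitz_on UNIV (\<lambda>x::'a. infdist x B)"
    by (intro lipschitz_onI) (auto simp: dist_real_def infdist_triangle_abs)
  from concentratedD(3)[OF conc this] obtain m
    where m: "measure M {\<omega> \<in> space M. \<bar>infdist (Z \<omega>) B - m\<bar> > r} \<le> \<alpha> r"
    using \<open>0 \<le> r\<close> by auto
  note [measurable] = concentratedD(2)[OF conc]
  have [measurable]: "(\<lambda>x::'a. infdist x B) \<in> borel_measurable borel"
    by (intro borel_measurable_continuous_onI continuous_intros)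
  have ev: "{\<omega> \<in> space M. \<bar>infdist (Z \<omega>) B - m\<bar> > r} \<in> sets M" by measurable
  \<comment> \<open>An event of probability above \<open>\<alpha> r\<close> does not fit inside one
    of probability at most \<open>\<alpha> r\<close>; an outcome left over has
    \<open>infdist\<close> 0 and forces \<open>m \<le> r\<close>.\<close>
  have "\<not> {\<omega> \<in> space M. Z \<omega> \<in> B} \<subseteq> {\<omega> \<in> space M. \<bar>infdist (Z \<omega>) B - m\<bar> > r}"
    using concentrated_mono[OF conc _ ev, of "{\<omega> \<in> space M. Z \<omega> \<in> B}"] m B by linarith
  then obtain \<omega> where "Z \<omega> \<in> B" "\<not> \<bar>infdist (Z \<omega>) B - m\<bar> > r" by blast
  then have "m \<le> r" by simp
  then have "measure M {\<omega> \<in> space M. infdist (Z \<omega>) B > 2 * r}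
      \<le> measure M {\<omega> \<in> space M. \<bar>infdist (Z \<omega>) B - m\<bar> > r}"
    by (intro concentrated_mono[OF conc] ev) auto
  with m show ?thesis by linarith
qed

text \<open>\<open>E \<inter> G\<close> has probability at least 1/2 minus that of leaving
  \<open>G\<close>, hence above \<open>\<alpha> r\<close>, so \<open>Z\<close> is within
  \<open>2 * r\<close> of it up to probability \<open>\<alpha> r\<close>. Leaving \<open>G\<close>
  is paid for only once, although \<open>G\<close> is required of both \<open>x\<close> and
  \<open>y\<close>.\<close>

lemma prob_not_in_le:
  fixes Z :: "'w \<Rightarrow> 'a::euclidean_space"
  assumes conc: "concentrated M Z \<alpha>"
    and "0 \<le> r" "closed E" "closed G" "closed G'"
    and E: "1/2 \<le> measure M {\<omega> \<in> space M. Z \<omega> \<in> E}"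
    and G: "measure M {\<omega> \<in> space M. Z \<omega> \<notin> G} + \<alpha> r < 1/2"
    and G': "\<And>x y. x \<in> G \<Longrightarrow> y \<in> G \<Longrightarrow> y \<in> E \<Longrightarrow> dist x y \<le> 2 * r \<Longrightarrow> x \<in> G'"
  shows "measure M {\<omega> \<in> space M. Z \<omega> \<notin> G'} \<le> measure M {\<omega> \<in> space M. Z \<omega> \<notin> G} + \<alpha> r"
proof -
  define B where "B = E \<inter> G"
  have "closed B" using assms by (auto simp: B_def)
  note ev = sets_vimage_closed[OF conc \<open>closed B\<close>] sets_vimage_closed[OF conc \<open>closed E\<close>]
    sets_vimage_closed[OF conc \<open>closed G\<close>] sets_vimage_closed[OF conc \<open>closed G'\<close>]
  have "measure M {\<omega> \<in> space M. Z \<omega> \<in> E}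
      \<le> measure M ({\<omega> \<in> space M. Z \<omega> \<in> B} \<union> {\<omega> \<in> space M. Z \<omega> \<notin> G})"
    by (intro concentrated_mono[OF conc] sets.Un ev) (auto simp: B_def)
  also have "\<dots> \<le> measure M {\<omega> \<in> space M. Z \<omega> \<in> B} + measure M {\<omega> \<in> space M. Z \<omega> \<notin> G}"
    using ev by (intro measure_Un_le)
  finally have *: "\<alpha> r < measure M {\<omega> \<in> space M. Z \<omega> \<in> B}" using E G by linarith
  have "0 \<le> \<alpha> r" using concentrated_bound_nonneg[OF conc] \<open>0 \<le> r\<close> .
  \<comment> \<open>Nonemptiness matters because \<open>infdist x {} = 0\<close> by convention;
    together with closedness it provides a nearest point of \<open>B\<close>.\<close>
  with * have "{\<omega> \<in> space M. Z \<omega> \<in> B} \<noteq> {}" by (auto simp del: Collect_empty_eq)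
  then have "B \<noteq> {}" by blast
  note [measurable] = concentratedD(2)[OF conc]
  have [measurable]: "(\<lambda>x::'a. infdist x B) \<in> borel_measurable borel"
    by (intro borel_measurable_continuous_onI continuous_intros)
  have far: "{\<omega> \<in> space M. infdist (Z \<omega>) B > 2 * r} \<in> sets M" by measurable
  have "x \<in> G'" if "x \<in> G" "infdist x B \<le> 2 * r" for x
    using infdist_attains_inf[OF \<open>closed B\<close> \<open>B \<noteq> {}\<close>, of x] that G' by (metis B_def IntE)
  then have "measure M {\<omega> \<in> space M. Z \<omega> \<notin> G'}
      \<le> measure M ({\<omega> \<in> space M. Z \<omega> \<notin> G} \<union> {\<omega> \<in> space M. infdist (Z \<omega>) B > 2 * r})"
    by (intro concentrated_mono[OF conc] sets.Un ev far) force
  also have "\<dots> \<le> measure M {\<omega> \<in> space M. Z \<omega> \<notin> G} + measure M {\<omega> \<in> space M. infdist (Z \<omega>) B > 2 * r}"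
    using ev far by (intro measure_Un_le)
  also have "measure M {\<omega> \<in> space M. infdist (Z \<omega>) B > 2 * r} \<le> \<alpha> r"
    using prob_infdist_gt_le[OF conc \<open>0 \<le> r\<close> \<open>closed B\<close> *] .
  finally show ?thesis by simp
qed

text \<open>\<open>F\<close> is controlled only between nearby points of \<open>G\<close>, so each
  tail is treated by propagation from a set of probability at least 1/2:
  \<open>{x. F x \<le> m}\<close> for the upper tail, \<open>{x. m \<le> F x}\<close> for the lower
  one.\<close>

lemma prob_deviation_le:
  fixes Z :: "'w \<Rightarrow> 'a::euclidean_space" and F :: "'a \<Rightarrow> real"
  assumes conc: "concentrated M Z \<alpha>"
    and "0 \<le> r" and F: "continuous_on UNIV F" and "closed G"
    and med: "is_median M (\<lambda>\<omega>. F (Z \<omega>)) m"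
    and G: "measure M {\<omega> \<in> space M. Z \<omega> \<notin> G} + \<alpha> r < 1/2"
    and diff: "\<And>x y. x \<in> G \<Longrightarrow> y \<in> G \<Longrightarrow> dist x y \<le> 2 * r \<Longrightarrow> \<bar>F x - F y\<bar> \<le> t"
  shows "measure M {\<omega> \<in> space M. \<bar>F (Z \<omega>) - m\<bar> > t} \<le> 2 * (measure M {\<omega> \<in> space M. Z \<omega> \<notin> G} + \<alpha> r)"
proof -
  define U where "U = {x. F x \<le> m + t}"
  define L where "L = {x. m - t \<le> F x}"
  have clo: "closed U" "closed L" "closed {x. F x \<le> m}" "closed {x. m \<le> F x}"
    unfolding U_def L_def by (intro closed_Collect_le continuous_intros F)+
  note ev = sets_vimage_closed[OF conc \<open>closed U\<close>] sets_vimage_closed[OF conc \<open>closed L\<close>]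
  have "measure M {\<omega> \<in> space M. \<bar>F (Z \<omega>) - m\<bar> > t}
      \<le> measure M ({\<omega> \<in> space M. Z \<omega> \<notin> U} \<union> {\<omega> \<in> space M. Z \<omega> \<notin> L})"
  proof (rule concentrated_mono[OF conc])
    show "{\<omega> \<in> space M. t < \<bar>F (Z \<omega>) - m\<bar>}
        \<subseteq> {\<omega> \<in> space M. Z \<omega> \<notin> U} \<union> {\<omega> \<in> space M. Z \<omega> \<notin> L}"
      unfolding U_def L_def by auto
  qed (intro sets.Un ev)
  also have "\<dots> \<le> measure M {\<omega> \<in> space M. Z \<omega> \<notin> U} + measure M {\<omega> \<in> space M. Z \<omega> \<notin> L}"
    using ev by (intro measure_Un_le)
  also have "measure M {\<omega> \<in> space M. Z \<omega> \<notin> U} \<le> measure M {\<omega> \<in> space M. Z \<omega> \<notin> G} + \<alpha> r"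
    using med diff clo
    by (intro prob_not_in_le[OF conc, of r "{x. F x \<le> m}"] assms) (fastforce simp: is_median_def U_def abs_le_iff)+
  also have "measure M {\<omega> \<in> space M. Z \<omega> \<notin> L} \<le> measure M {\<omega> \<in> space M. Z \<omega> \<notin> G} + \<alpha> r"
    using med diff clo
    by (intro prob_not_in_le[OF conc, of r "{x. m \<le> F x}"] assms) (fastforce simp: is_median_def L_def abs_le_iff)+
  finally show ?thesis by simp
qed

section \<open>Descent through the orders of differentiation\<close>

text \<open>Each order from \<open>d - 1\<close> down to 1 costs \<open>\<alpha> r\<close>, the
  final comparison of values costs one more, and the two tails double the total.\<close>

lemma prob_deviation_le_of_medians:
  fixes Z :: "'w \<Rightarrow> 'a::euclidean_space" and \<Phi> :: "'a \<Rightarrow> 'b::real_normed_vector" and g :: "'b \<Rightarrow> real"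
  assumes conc: "concentrated M Z \<alpha>"
    and \<Phi>: "times_differentiable d \<Phi>" and "1 \<le> d"
    and bdd: "bdd_above (range (\<lambda>x. k_linear_norm d (differential d \<Phi> x)))"
    and g: "1-lipschitz_on UNIV g"
    and med_g: "is_median M (\<lambda>\<omega>. g (\<Phi> (Z \<omega>))) m\<^sub>g"
    and med: "\<And>k. 1 \<le> k \<Longrightarrow> k < d \<Longrightarrow>
      is_median M (\<lambda>\<omega>. k_linear_norm k (differential k \<Phi> (Z \<omega>))) (m k)"
    and "0 < r" "0 < t"
    and m_le: "\<And>k. 1 \<le> k \<Longrightarrow> k < d \<Longrightarrow> m k * (exp 1 * r) ^ k \<le> t / d"
    and top: "\<And>z. k_linear_norm d (differential d \<Phi> z) * (exp 1 * r) ^ d \<le> t / d"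
    and small: "real d * \<alpha> r < 1/2"
  shows "measure M {\<omega> \<in> space M. \<bar>g (\<Phi> (Z \<omega>)) - m\<^sub>g\<bar> > t} \<le> 2 * (real d * \<alpha> r)"
proof -
  define R where "R = exp 1 * r"
  define \<tau> where "\<tau> = t / d"
  define h where "h = (\<lambda>k x. k_linear_norm k (differential k \<Phi> x))"
  \<comment> \<open>The allowance at order \<open>j\<close> is one \<open>\<tau>\<close> for the
    median and \<open>d - j\<close> of them for the variation between nearby points.
    \<open>G d\<close> is the whole space, the range of \<open>j\<close> being empty.\<close>
  define G where "G = (\<lambda>k. {x. \<forall>j\<in>{k..<d}. h j x * R ^ j \<le> real (d - j + 1) * \<tau>})"
  have "0 < R" using \<open>0 < r\<close> by (simp add: R_def)
  have "0 < \<tau>" "t = d * \<tau>" using \<open>0 < t\<close> \<open>1 \<le> d\<close> by (auto simp: \<tau>_def)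
  have "0 \<le> \<alpha> r" using concentrated_bound_nonneg[OF conc] \<open>0 < r\<close> by simp
  have cont: "continuous_on UNIV (h k)" if "k < d" for k
    using continuous_on_k_linear_norm_differential[OF \<Phi> bdd that] by (simp add: h_def)
  have "G k = (\<Inter>j\<in>{k..<d}. {x. h j x * R ^ j \<le> real (d - j + 1) * \<tau>})" for k
    by (auto simp: G_def)
  then have clo: "closed (G k)" for k
    by (auto intro!: closed_INT closed_Collect_le continuous_intros cont)
  \<comment> \<open>The common bound is \<open>B = (d - k) * \<tau>\<close>: it covers orders
    \<open>j > k\<close> since \<open>d - j + 1 \<le> d - k\<close>, and the top order since
    \<open>1 \<le> d - k\<close>.\<close>
  have step: "norm (differential k \<Phi> x hs - differential k \<Phi> y hs) \<le> real (d - k) * \<tau> / R ^ k"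
    if "k < d" "x \<in> G (Suc k)" "y \<in> G (Suc k)" "dist x y \<le> 2 * r"
      "length hs = k" "\<forall>v\<in>set hs. norm v \<le> 1" for k x y hs
    unfolding R_def
  proof (rule norm_differential_diff_le_scaled[OF \<Phi> \<open>k < d\<close> \<open>0 < r\<close>])
    have "1 * \<tau> \<le> real (d - k) * \<tau>" using \<open>0 < \<tau>\<close> \<open>k < d\<close> by (intro mult_right_mono) auto
    with top show "k_linear_norm d (differential d \<Phi> z) * (exp 1 * r) ^ d \<le> real (d - k) * \<tau>" for z
      unfolding \<tau>_def using order_trans by fastforce
    show "k_linear_norm j (differential j \<Phi> z) * (exp 1 * r) ^ j \<le> real (d - k) * \<tau>"
      if "k < j" "j < d" "z \<in> {x, y}" for j z
    proof -
      have "h j z * R ^ j \<le> real (d - j + 1) * \<tau>"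
        using that \<open>x \<in> G (Suc k)\<close> \<open>y \<in> G (Suc k)\<close> by (auto simp: G_def)
      also have "\<dots> \<le> real (d - k) * \<tau>"
        using that \<open>0 < \<tau>\<close> by (intro mult_right_mono) auto
      finally show ?thesis by (simp add: h_def R_def)
    qed
  qed (use that \<open>0 < \<tau>\<close> in auto)
  \<comment> \<open>Here \<open>n\<close> counts the orders treated; \<open>n < d\<close> stops the
    descent at order 1, the lowest order with a median.\<close>
  have "measure M {\<omega> \<in> space M. Z \<omega> \<notin> G (d - n)} \<le> n * \<alpha> r" if "n < d" for n
    using that
  proof (induction n)
    case 0
    show ?case by (simp add: G_def)
  next
    case (Suc n)
    define k where "k = d - Suc n"
    have k: "1 \<le> k" "k < d" "d - n = Suc k" using Suc.prems by (auto simp: k_def)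
    have IH: "measure M {\<omega> \<in> space M. Z \<omega> \<notin> G (Suc k)} \<le> n * \<alpha> r" using Suc k by simp
    have "measure M {\<omega> \<in> space M. Z \<omega> \<notin> G k} \<le> measure M {\<omega> \<in> space M. Z \<omega> \<notin> G (Suc k)} + \<alpha> r"
    proof (rule prob_not_in_le[OF conc, of _ "{x. h k x \<le> m k}"])
      show "closed {x. h k x \<le> m k}"
        using cont[OF \<open>k < d\<close>] by (intro closed_Collect_le continuous_intros) auto
      show "1/2 \<le> measure M {\<omega> \<in> space M. Z \<omega> \<in> {x. h k x \<le> m k}}"
        using med[OF k(1,2)] by (simp add: is_median_def h_def)
      \<comment> \<open>As \<open>Suc n < d\<close>, smallness of \<open>d * \<alpha> r\<close>
        keeps every intermediate probability below 1/2.\<close>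
      have "real (Suc n) * \<alpha> r \<le> real d * \<alpha> r"
        using \<open>0 \<le> \<alpha> r\<close> Suc.prems by (intro mult_right_mono) auto
      then show "measure M {\<omega> \<in> space M. Z \<omega> \<notin> G (Suc k)} + \<alpha> r < 1/2"
        using IH small by (simp add: algebra_simps)
      show "x \<in> G k"
        if xy: "x \<in> G (Suc k)" "y \<in> G (Suc k)" "y \<in> {x. h k x \<le> m k}" "dist x y \<le> 2 * r" for x y
      proof -
        have "h k x \<le> h k y + real (d - k) * \<tau> / R ^ k"
          unfolding h_def using k xy k_linear_differential[OF \<Phi>, of k]
          by (intro k_linear_norm_le_add step) auto
        also have "\<dots> \<le> m k + real (d - k) * \<tau> / R ^ k" using xy by simp
        finally have "h k x * R ^ k \<le> (m k + real (d - k) * \<tau> / R ^ k) * R ^ k"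
          using \<open>0 < R\<close> by (intro mult_right_mono) auto
        also have "\<dots> = m k * R ^ k + real (d - k) * \<tau>"
          using \<open>0 < R\<close> by (simp add: distrib_right)
        also have "\<dots> \<le> real (d - k + 1) * \<tau>"
          using m_le[OF k(1,2), folded R_def \<tau>_def] by (simp add: distrib_right)
        finally have "h k x * R ^ k \<le> real (d - k + 1) * \<tau>" .
        moreover have "{k..<d} = insert k {Suc k..<d}" using k by auto
        ultimately show ?thesis using xy(1) k(2) by (auto simp: G_def of_nat_diff)
      qed
    qed (use clo \<open>0 < r\<close> in auto)
    also have "\<dots> \<le> real (Suc n) * \<alpha> r" using IH by (simp add: algebra_simps)
    finally show ?case by (simp add: k_def)
  qed
  from this[of "d - 1"] have G: "measure M {\<omega> \<in> space M. Z \<omega> \<notin> G 1} \<le> real (d - 1) * \<alpha> r"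
    using \<open>1 \<le> d\<close> by simp
  then have G1: "measure M {\<omega> \<in> space M. Z \<omega> \<notin> G 1} + \<alpha> r \<le> real d * \<alpha> r"
    using \<open>1 \<le> d\<close> by (simp add: of_nat_diff algebra_simps)
  have "measure M {\<omega> \<in> space M. \<bar>g (\<Phi> (Z \<omega>)) - m\<^sub>g\<bar> > t} \<le> 2 * (measure M {\<omega> \<in> space M. Z \<omega> \<notin> G 1} + \<alpha> r)"
  proof (rule prob_deviation_le[OF conc _ _ clo med_g])
    show "continuous_on UNIV (\<lambda>x. g (\<Phi> x))"
      using continuous_on_compose2[OF lipschitz_on_continuous_on[OF g]
          continuous_on_times_differentiable[OF \<Phi> \<open>1 \<le> d\<close>]] by simp
    show "\<bar>g (\<Phi> x) - g (\<Phi> y)\<bar> \<le> t" if "x \<in> G 1" "y \<in> G 1" "dist x y \<le> 2 * r" for x y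
    proof -
      have "\<bar>g (\<Phi> x) - g (\<Phi> y)\<bar> \<le> norm (\<Phi> x - \<Phi> y)"
        using lipschitz_onD[OF g, of "\<Phi> x" "\<Phi> y"] by (simp add: dist_norm)
      \<comment> \<open>At order 0 the variation bound is \<open>d * \<tau> = t\<close>, which
        explains the division of \<open>t\<close> by \<open>d\<close>.\<close>
      also have "\<dots> \<le> t"
        using step[of 0 x y "[]"] that \<open>1 \<le> d\<close> \<open>t = d * \<tau>\<close> by simp
      finally show ?thesis .
    qed
  qed (use \<open>0 < r\<close> G1 small in auto)
  also have "\<dots> \<le> 2 * (real d * \<alpha> r)" using G1 by simp
  finally show ?thesis .
qed

section \<open>Choice of the radius and degenerate cases\<close>

theorem theorem0p3:
  fixes M :: "'w measure" and Z :: "'w \<Rightarrow> real ^ 'n" and \<alpha> :: "real \<Rightarrow> real"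
    and d :: nat and \<Phi> :: "real ^ 'n \<Rightarrow> real ^ 'p" and g :: "real ^ 'p \<Rightarrow> real"
    and m :: "nat \<Rightarrow> real" and m\<^sub>g :: real
  assumes "prob_space M"
    and "Z \<in> borel_measurable M"
    and "\<forall>t\<ge>0. \<alpha> t \<ge> 0"
    and "antimono_on {0..} \<alpha>"
    and "\<forall>f :: real ^ 'n \<Rightarrow> real. 1-lipschitz_on UNIV f \<longrightarrow>
           (\<exists>m\<^sub>f. is_median M (\<lambda>\<omega>. f (Z \<omega>)) m\<^sub>f \<and>
             (\<forall>t\<ge>0. measure M {\<omega> \<in> space M. \<bar>f (Z \<omega>) - m\<^sub>f\<bar> > t} \<le> \<alpha> t))"
    and "d \<ge> 1"
    and "times_differentiable d \<Phi>"
    and "bdd_above (range (\<lambda>x. k_linear_norm d (differential d \<Phi> x)))"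
    and "1-lipschitz_on UNIV g"
    and "is_median M (\<lambda>\<omega>. g (\<Phi> (Z \<omega>))) m\<^sub>g"
    and "\<forall>k\<in>{1..d-1}. is_median M (\<lambda>\<omega>. k_linear_norm k (differential k \<Phi> (Z \<omega>))) (m k)"
    and "m d = (SUP x. k_linear_norm d (differential d \<Phi> x))"
  shows "\<forall>t\<ge>0. measure M {\<omega> \<in> space M. \<bar>g (\<Phi> (Z \<omega>)) - m\<^sub>g\<bar> > t}
           \<le> concentration_bound d \<alpha> m t"
proof (intro allI impI)
  fix t :: real assume "0 \<le> t"
  have conc: "concentrated M Z \<alpha>" using assms(1,2,5) by (simp add: concentrated_def)
  let ?h = "\<lambda>k x. k_linear_norm k (differential k \<Phi> x)"
  let ?P = "measure M {\<omega> \<in> space M. \<bar>g (\<Phi> (Z \<omega>)) - m\<^sub>g\<bar> > t}"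
  have "1 \<le> d" by fact
  have \<Phi>: "times_differentiable d \<Phi>" by fact
  have med: "is_median M (\<lambda>\<omega>. ?h k (Z \<omega>)) (m k)" if "1 \<le> k" "k < d" for k
    using assms(11) that by simp
  have h_le: "?h d x \<le> m d" for x
    unfolding assms(12) by (rule cSUP_upper[OF UNIV_I assms(8)])
  have h_nonneg: "0 \<le> ?h k x" if "k \<le> d" for k x
    using k_linear_norm_nonneg k_linear_differential[OF \<Phi> that] by blast
  have m_nonneg: "0 \<le> m k" if "1 \<le> k" "k \<le> d" for k
  proof (cases "k = d")
    case True
    then show ?thesis using h_le[of 0] h_nonneg[of d 0] by simp
  next
    case False
    then have "k < d" using that by simp
    from median_set_nonempty[OF med[OF \<open>1 \<le> k\<close> this]] obtain \<omega> where "?h k (Z \<omega>) \<le> m k" by blast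
    then show ?thesis using order_trans[OF h_nonneg[OF \<open>k \<le> d\<close>]] by blast
  qed
  have "2 * (2::nat) ^ (d - 1) = 2 ^ d" using \<open>1 \<le> d\<close> by (cases d) auto
  then have two_d: "2 * d \<le> 2 ^ d" using less_exp[of "d - 1"] by linarith
  \<comment> \<open>If \<open>2 ^ d * \<alpha> r \<ge> 1\<close>, the bound is trivial for a
    probability; otherwise \<open>2 * d \<le> 2 ^ d\<close> yields
    \<open>d * \<alpha> r < 1/2\<close> and absorbs \<open>2 * d\<close> into
    \<open>2 ^ d\<close>.\<close>
  have reduce: "?P \<le> 2 ^ d * \<alpha> r" if "0 \<le> r" "real d * \<alpha> r < 1/2 \<Longrightarrow> ?P \<le> 2 * (real d * \<alpha> r)" for r
  proof (cases "2 ^ d * \<alpha> r < 1")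
    case True
    have "real (2 * d) * \<alpha> r \<le> real (2 ^ d) * \<alpha> r"
      using two_d assms(3) \<open>0 \<le> r\<close> by (intro mult_right_mono) (simp_all only: of_nat_le_iff)
    then show ?thesis using True that by simp
  next
    case False
    then show ?thesis using order_trans[OF prob_space.prob_le_1[OF assms(1)], of "2 ^ d * \<alpha> r"] by simp
  qed
  show "?P \<le> concentration_bound d \<alpha> m t"
  proof (cases "t = 0")
    case True
    have "?P \<le> 2 ^ d * \<alpha> 0"
    proof (rule reduce)
      assume small: "real d * \<alpha> 0 < 1/2"
      have "1 * \<alpha> 0 \<le> real d * \<alpha> 0" using \<open>1 \<le> d\<close> assms(3) by (intro mult_right_mono) auto
      have "continuous_on UNIV (\<lambda>x. g (\<Phi> x))"
        using continuous_on_compose2[OF lipschitz_on_continuous_on[OF assms(9)]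
            continuous_on_times_differentiable[OF \<Phi> \<open>1 \<le> d\<close>]] by simp
      \<comment> \<open>With radius 0 the two compared points coincide, so \<open>G = UNIV\<close>
        serves and no bound on differentials enters.\<close>
      then have "?P \<le> 2 * (measure M {\<omega> \<in> space M. Z \<omega> \<notin> UNIV} + \<alpha> 0)"
        using True small \<open>1 * \<alpha> 0 \<le> real d * \<alpha> 0\<close> assms(10)
        by (intro prob_deviation_le[OF conc]) auto
      then show "?P \<le> 2 * (real d * \<alpha> 0)" using \<open>1 * \<alpha> 0 \<le> real d * \<alpha> 0\<close> by simp
    qed simp
    then show ?thesis using True by (simp add: concentration_bound_def)
  next
    case False
    then have "0 < t" using \<open>0 \<le> t\<close> by simp
    show ?thesis
    proof (cases "\<forall>k\<in>{1..d}. m k = 0")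
      case True
      have "\<Phi> x = \<Phi> y" for x y
      proof (rule constant_if_medians_vanish[OF \<Phi> \<open>1 \<le> d\<close>])
        show "?h d z \<le> 0" for z using h_le[of z] True \<open>1 \<le> d\<close> by simp
        show "is_median M (\<lambda>\<omega>. ?h k (Z \<omega>)) 0" if "1 \<le> k" "k < d" for k
          using med[OF that] True that by simp
      qed
      \<comment> \<open>The values below and above the median that its definition provides are the
        same constant.\<close>
      then have "g (\<Phi> (Z \<omega>)) = m\<^sub>g" for \<omega>
        using median_set_nonempty[OF assms(10)] by (metis order_antisym)
      then have "?P = 0" using \<open>0 < t\<close> by simp
      then show ?thesis using True \<open>0 < t\<close> by (simp add: concentration_bound_def)
    next
      case False
      define S where "S = (\<lambda>k. root k (t / (real d * m k))) ` {k\<in>{1..d}. m k \<noteq> 0}"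
      define r where "r = 1 / exp 1 * Min S"
      have S: "finite S" "S \<noteq> {}" using False by (auto simp: S_def)
      have "0 < s" if "s \<in> S" for s
        using that \<open>0 < t\<close> m_nonneg \<open>1 \<le> d\<close>
        by (auto simp: S_def intro!: divide_pos_pos mult_pos_pos simp: less_le)
      then have "0 < r" using S by (simp add: r_def)
      \<comment> \<open>A retained index has its root term at least the minimum
        \<open>exp 1 * r\<close>, and the \<open>k\<close>-th power gives the claim; for a dropped
        index the left-hand side is 0.\<close>
      have m_le: "m k * (exp 1 * r) ^ k \<le> t / d" if k: "1 \<le> k" "k \<le> d" for k
      proof (cases "m k = 0")
        case True
        then show ?thesis using \<open>0 < t\<close> by simp
      next
        case False
        then have "0 < m k" using m_nonneg k by (simp add: less_le)
        have "exp 1 * r \<le> root k (t / (real d * m k))"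
          using False k S by (auto simp: r_def S_def intro!: Min_le)
        then have "(exp 1 * r) ^ k \<le> root k (t / (real d * m k)) ^ k"
          using \<open>0 < r\<close> by (intro power_mono) auto
        also have "\<dots> = t / (real d * m k)"
          using k \<open>0 < t\<close> \<open>0 < m k\<close> by (intro real_root_pow_pos2) auto
        finally show ?thesis using \<open>0 < m k\<close> \<open>1 \<le> d\<close> by (simp add: field_simps)
      qed
      have top: "?h d z * (exp 1 * r) ^ d \<le> t / d" for z
        using order_trans[OF mult_right_mono[OF h_le] m_le[of d]] \<open>1 \<le> d\<close> \<open>0 < r\<close> by simp
      have "?P \<le> 2 ^ d * \<alpha> r"
      proof (rule reduce)
        assume "real d * \<alpha> r < 1/2"
        then show "?P \<le> 2 * (real d * \<alpha> r)"
          using prob_deviation_le_of_medians[OF conc \<Phi> \<open>1 \<le> d\<close> assms(8,9,10) med \<open>0 < r\<close> \<open>0 < t\<close> m_le top]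
          by simp
      qed (use \<open>0 < r\<close> in simp)
      moreover have "concentration_bound d \<alpha> m t = 2 ^ d * \<alpha> r"
        using False \<open>0 < t\<close> unfolding concentration_bound_def r_def S_def by auto
      ultimately show ?thesis by simp
    qed
  qed
qed

end
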